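(* Let $R$ be a commutative unital ring with $0\neq 1$ and let $E$ be an algebraically closed field which is an $R$-algebra. The map of multiplicative summations $\mathcal{U}:\mathbf{MS}(R,E)\to\mathbf{MS}(R,E)$, sending a multiplicative summation $(D,S)$ to its univalent extension $(\mathcal{U}D,\mathcal{U}S)$, is a well-defined extension map (that is, $\mathcal{U}S$ is a multiplicative summation extending $S$). Moreover, $\mathcal{U}$ is idempotent, multiplicatively canonical, preserves multiplicative compatibility, and subsumes $\mathcal{T}$ (telescopic extension) and $\mathcal{Q}$ (rational extension).
   Context: A multiplicative summation on $R$ to $E$ is a pair $(D,S)$ where $R[\sigma]\subseteq D\subseteq R[[\sigma]]$, $D$ is an $R$-subalgebra of the formal power series ring $R[[\sigma]]$, $S:D\to E$ is a (unital) $R$-algebra homomorphism, $(1-\sigma)D\subseteq D$, and $S$ vanishes on $(1-\sigma)D$. Write $\mathbf{MS}(R,E)$ for the set of these. $(D',S')$ extends $(D,S)$ if $D\subseteq D'$ and $S'|_D=S$; all extensions are in $\mathbf{MS}(R,E)$. Two elements of $\mathbf{MS}(R,E)$ are multiplicatively compatible if they have a common extension in $\mathbf{MS}(R,E)$. An extension of $S$ is multiplicatively $S$-canonical if it is multiplicatively compatible with every extension of $S$. For a map $\Phi:\mathbf{MS}(R,E)\to\mathbf{MS}(R,E)$: $\Phi$ is an extension map if $\Phi S$ extends $S$ for all $S$; $\Phi$ is idempotent if $\Phi\Phi S=\Phi S$; $\Phi$ is multiplicatively canonical if $\Phi S$ is multiplicatively $S$-canonical for all $S$; $\Phi$ preserves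 multiplicative compatibility if $\Phi S_1,\Phi S_2$ are multiplicatively compatible whenever $S_1,S_2$ are; $\Phi$ subsumes $\Psi$ if $\Phi\Psi S=\Psi\Phi S=\Phi S$ for all $S$. Scalar polynomials. For $P(T)=\sum_k P_kT^k\in D[T]$ put $S(P)(t)=\sum_k S(P_k)t^k\in E[t]$. For $X\in R[[\sigma]]$ let $\mathrm{A}(X;S)=\{P(T)\in D[T] : P(X)=0,\ S(P)(t)\neq 0\}$. A polynomial $P\in \mathrm{A}(X;S)$ for which $\deg S(P)(t)$ is minimal is called $S$-minimal for $X$. The scalar polynomial $s_X(t)\in E[t]$ of $X$ over $S$ is $0$ if $\mathrm{A}(X;S)=\emptyset$; otherwise it is the unique monic polynomial which is a nonzero scalar multiple of $S(P)(t)$ for some (equivalently every) $S$-minimal $P$ for $X$. $X$ is $S$-algebraic if $s_X(t)$ is nonconstant, and absolutely $S$-algebraic if it is $S'$-algebraic for every extension $S'$ of $S$ (including $S$ itself). $X$ is absolutely $S$-univalent with root $\rho_X$ if it is absolutely $S$-algebraic and $s_X(t)=(t-\rho_X)^m$ for some $\rho_X\in E$ and $m>0$. Univalent extension: $\mathcal{U}D$ is the set of absolutely $S$-univalent series $X\in R[[\sigma]]$, and $\mathcal{U}S:\mathcal{U}D\to E$ is $X\mapsto\rho_X$. Rational extension: $X\in\mathcal{Q}D$ iff there are $A,B\in D$ and $x\in E$ with $A=BX$, $S(B)\neq 0$ and $S(A)=S(B)x$; then $\mathcal{Q}S(X)=x$. Telescopic extension: $X\in\mathcal{T}D$ iff there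 are $A\in D$, $F\in R[\sigma]$ and $x\in E$ with $A=FX$, $S(F)\neq0$ and $S(A)=S(F)x$; then $\mathcal{T}S(X)=x$. Both are well-defined and give elements of $\mathbf{MS}(R,E)$. *)

theory Defs
  imports
    "HOL-Library.FuncSet"
    "HOL-Computational_Algebra.Computational_Algebra"
begin

text \<open>
  The \<open>R\<close>-algebra structure of \<open>E\<close> is given by its scalar multiplication \<open>scale\<close>. The formal
  power series ring \<open>R[[\<sigma>]]\<close> is \<open>'r fps\<close> with \<open>\<sigma> = fps_X\<close>; its scalar multiplication is
  \<open>\<lambda>r X. fps_const r * X\<close>, and \<open>R[\<sigma>]\<close> is \<open>range fps_of_poly\<close>.
\<close>

locale comm_algebra = module scale
  for scale :: "'r::comm_ring_1 \<Rightarrow> 'e::comm_ring_1 \<Rightarrow> 'e" +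
  assumes scale_mult_left: "scale r (x * y) = scale r x * y"

definition fps_subalgebra :: "'r::comm_ring_1 fps set \<Rightarrow> bool" where
  "fps_subalgebra D \<longleftrightarrow>
     1 \<in> D \<and>
     (\<forall>X\<in>D. \<forall>Y\<in>D. X + Y \<in> D \<and> X * Y \<in> D) \<and>
     (\<forall>r. \<forall>X\<in>D. fps_const r * X \<in> D)"

definition fps_algebra_hom ::
  "('r::comm_ring_1 \<Rightarrow> 'e::comm_ring_1 \<Rightarrow> 'e) \<Rightarrow> 'r fps set \<Rightarrow> ('r fps \<Rightarrow> 'e) \<Rightarrow> bool" where
  "fps_algebra_hom scale D S \<longleftrightarrow>
     S 1 = 1 \<and>
     (\<forall>X\<in>D. \<forall>Y\<in>D. S (X + Y) = S X + S Y \<and> S (X * Y) = S X * S Y) \<and>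
     (\<forall>r. \<forall>X\<in>D. S (fps_const r * X) = scale r (S X))"

text \<open>
  A map \<open>S : D \<rightarrow> E\<close> is represented by a total function that is \<open>undefined\<close> outside \<open>D\<close>, so that
  equality of pairs is equality of multiplicative summations.
\<close>

type_synonym ('r, 'e) summation = "'r fps set \<times> ('r fps \<Rightarrow> 'e)"

definition MS :: "('r::comm_ring_1 \<Rightarrow> 'e::comm_ring_1 \<Rightarrow> 'e) \<Rightarrow> ('r, 'e) summation set" where
  "MS scale = {(D, S).
     range fps_of_poly \<subseteq> D \<and> fps_subalgebra D \<and>
     S \<in> extensional D \<and> fps_algebra_hom scale D S \<and>
     (\<forall>X\<in>D. (1 - fps_X) * X \<in> D \<and> S ((1 - fps_X) * X) = 0)}"

definition extends ::
  "('r::comm_ring_1 \<Rightarrow> 'e::comm_ring_1 \<Rightarrow> 'e) \<Rightarrow> ('r, 'e) summation \<Rightarrow> ('r, 'e) summation \<Rightarrow> bool" where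
  "extends scale S' S \<longleftrightarrow>
     S' \<in> MS scale \<and> S \<in> MS scale \<and> fst S \<subseteq> fst S' \<and> (\<forall>X\<in>fst S. snd S' X = snd S X)"

definition mult_compatible ::
  "('r::comm_ring_1 \<Rightarrow> 'e::comm_ring_1 \<Rightarrow> 'e) \<Rightarrow> ('r, 'e) summation \<Rightarrow> ('r, 'e) summation \<Rightarrow> bool" where
  "mult_compatible scale S\<^sub>1 S\<^sub>2 \<longleftrightarrow> (\<exists>S'. extends scale S' S\<^sub>1 \<and> extends scale S' S\<^sub>2)"

definition mult_canonical ::
  "('r::comm_ring_1 \<Rightarrow> 'e::comm_ring_1 \<Rightarrow> 'e) \<Rightarrow> ('r, 'e) summation \<Rightarrow> ('r, 'e) summation \<Rightarrow> bool" where
  "mult_canonical scale S C \<longleftrightarrow>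
     extends scale C S \<and> (\<forall>S'. extends scale S' S \<longrightarrow> mult_compatible scale C S')"

subsection \<open>Properties of maps \<open>MS(R,E) \<rightarrow> MS(R,E)\<close>\<close>

definition extension_map ::
  "('r::comm_ring_1 \<Rightarrow> 'e::comm_ring_1 \<Rightarrow> 'e) \<Rightarrow> (('r, 'e) summation \<Rightarrow> ('r, 'e) summation) \<Rightarrow> bool" where
  "extension_map scale \<Phi> \<longleftrightarrow> (\<forall>S\<in>MS scale. extends scale (\<Phi> S) S)"

definition idempotent_map ::
  "('r::comm_ring_1 \<Rightarrow> 'e::comm_ring_1 \<Rightarrow> 'e) \<Rightarrow> (('r, 'e) summation \<Rightarrow> ('r, 'e) summation) \<Rightarrow> bool" where
  "idempotent_map scale \<Phi> \<longleftrightarrow> (\<forall>S\<in>MS scale. \<Phi> (\<Phi> S) = \<Phi> S)"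

definition mult_canonical_map ::
  "('r::comm_ring_1 \<Rightarrow> 'e::comm_ring_1 \<Rightarrow> 'e) \<Rightarrow> (('r, 'e) summation \<Rightarrow> ('r, 'e) summation) \<Rightarrow> bool" where
  "mult_canonical_map scale \<Phi> \<longleftrightarrow> (\<forall>S\<in>MS scale. mult_canonical scale S (\<Phi> S))"

definition preserves_mult_compatibility ::
  "('r::comm_ring_1 \<Rightarrow> 'e::comm_ring_1 \<Rightarrow> 'e) \<Rightarrow> (('r, 'e) summation \<Rightarrow> ('r, 'e) summation) \<Rightarrow> bool" where
  "preserves_mult_compatibility scale \<Phi> \<longleftrightarrow>
     (\<forall>S\<^sub>1\<in>MS scale. \<forall>S\<^sub>2\<in>MS scale.
        mult_compatible scale S\<^sub>1 S\<^sub>2 \<longrightarrow> mult_compatible scale (\<Phi> S\<^sub>1) (\<Phi> S\<^sub>2))"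

definition subsumes ::
  "('r::comm_ring_1 \<Rightarrow> 'e::comm_ring_1 \<Rightarrow> 'e) \<Rightarrow> (('r, 'e) summation \<Rightarrow> ('r, 'e) summation)
     \<Rightarrow> (('r, 'e) summation \<Rightarrow> ('r, 'e) summation) \<Rightarrow> bool" where
  "subsumes scale \<Phi> \<Psi> \<longleftrightarrow> (\<forall>S\<in>MS scale. \<Phi> (\<Psi> S) = \<Phi> S \<and> \<Psi> (\<Phi> S) = \<Phi> S)"

subsection \<open>Scalar polynomials\<close>

text \<open>
  A polynomial in \<open>D[T]\<close> is an \<open>'r fps poly\<close> all of whose coefficients lie in \<open>D\<close>; for such \<open>P\<close>,
  \<open>S(P)(t)\<close> is \<open>map_poly S P\<close> (note that \<open>S 0 = 0\<close> for a multiplicative summation).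
\<close>

definition annihilators :: "('r::comm_ring_1, 'e::field) summation \<Rightarrow> 'r fps \<Rightarrow> 'r fps poly set" where
  "annihilators S X =
     {P. (\<forall>i. coeff P i \<in> fst S) \<and> poly P X = 0 \<and> map_poly (snd S) P \<noteq> 0}"

definition is_minimal_for :: "('r::comm_ring_1, 'e::field) summation \<Rightarrow> 'r fps \<Rightarrow> 'r fps poly \<Rightarrow> bool" where
  "is_minimal_for S X P \<longleftrightarrow>
     is_arg_min (\<lambda>P. degree (map_poly (snd S) P)) (\<lambda>P. P \<in> annihilators S X) P"

definition scalar_poly :: "('r::comm_ring_1, 'e::field) summation \<Rightarrow> 'r fps \<Rightarrow> 'e poly" where
  "scalar_poly S X =
     (if annihilators S X = {} then 0
      else (THE s. lead_coeff s = 1 \<and>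
              (\<exists>P c. is_minimal_for S X P \<and> c \<noteq> 0 \<and> s = smult c (map_poly (snd S) P))))"

definition is_algebraic :: "('r::comm_ring_1, 'e::field) summation \<Rightarrow> 'r fps \<Rightarrow> bool" where
  "is_algebraic S X \<longleftrightarrow> degree (scalar_poly S X) > 0"

definition abs_algebraic ::
  "('r::comm_ring_1 \<Rightarrow> 'e::field \<Rightarrow> 'e) \<Rightarrow> ('r, 'e) summation \<Rightarrow> 'r fps \<Rightarrow> bool" where
  "abs_algebraic scale S X \<longleftrightarrow> (\<forall>S'. extends scale S' S \<longrightarrow> is_algebraic S' X)"

definition abs_univalent_with_root ::
  "('r::comm_ring_1 \<Rightarrow> 'e::field \<Rightarrow> 'e) \<Rightarrow> ('r, 'e) summation \<Rightarrow> 'r fps \<Rightarrow> 'e \<Rightarrow> bool" where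
  "abs_univalent_with_root scale S X \<rho> \<longleftrightarrow>
     abs_algebraic scale S X \<and> (\<exists>m>0. scalar_poly S X = [:- \<rho>, 1:] ^ m)"

subsection \<open>Univalent, rational and telescopic extensions\<close>

definition univalent_ext ::
  "('r::comm_ring_1 \<Rightarrow> 'e::field \<Rightarrow> 'e) \<Rightarrow> ('r, 'e) summation \<Rightarrow> ('r, 'e) summation" where
  "univalent_ext scale S =
     (let UD = {X. \<exists>\<rho>. abs_univalent_with_root scale S X \<rho>}
      in (UD, restrict (\<lambda>X. THE \<rho>. abs_univalent_with_root scale S X \<rho>) UD))"

definition rational_value :: "('r::comm_ring_1, 'e::field) summation \<Rightarrow> 'r fps \<Rightarrow> 'e \<Rightarrow> bool" where
  "rational_value S X x \<longleftrightarrow>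
     (\<exists>A\<in>fst S. \<exists>B\<in>fst S. A = B * X \<and> snd S B \<noteq> 0 \<and> snd S A = snd S B * x)"

definition rational_ext :: "('r::comm_ring_1, 'e::field) summation \<Rightarrow> ('r, 'e) summation" where
  "rational_ext S =
     (let QD = {X. \<exists>x. rational_value S X x}
      in (QD, restrict (\<lambda>X. THE x. rational_value S X x) QD))"

definition telescopic_value :: "('r::comm_ring_1, 'e::field) summation \<Rightarrow> 'r fps \<Rightarrow> 'e \<Rightarrow> bool" where
  "telescopic_value S X x \<longleftrightarrow>
     (\<exists>A\<in>fst S. \<exists>F\<in>range fps_of_poly. A = F * X \<and> snd S F \<noteq> 0 \<and> snd S A = snd S F * x)"

definition telescopic_ext :: "('r::comm_ring_1, 'e::field) summation \<Rightarrow> ('r, 'e) summation" where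
  "telescopic_ext S =
     (let TD = {X. \<exists>x. telescopic_value S X x}
      in (TD, restrict (\<lambda>X. THE x. telescopic_value S X x) TD))"

end

(* The roots of the scalar polynomial of X over S are exactly the values that extensions of S can
   assign to X: S(P)(x) = 0 for all relations P(X) = 0 over D is what is needed to extend S to D[X] by
   mapping X to x. By Zorn's lemma every multiplicative summation has maximal extensions, and since E
   is algebraically closed, X is absolutely univalent with root rho iff every maximal extension of S
   is defined at X with value rho. So US is the intersection of all maximal extensions of S, and all
   claims follow from this; an extension T of S satisfies UT = US as soon as it lies below every
   maximal extension of S. *)
theory Submission
  imports Defs
begin

section \<open>Multiplicative summations and the order of extensions\<close>

text \<open>Multiplicativity reduces vanishing on multiples of \<open>1 - fps_X\<close>, and
  likewise \<open>R\<close>-linearity, to the values of \<open>S\<close> at \<open>fps_X\<close> and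
  at the constants. Constructing a summation thus comes down to ring laws and a few values.\<close>

lemma MS_iff:
  fixes scale :: "'r::comm_ring_1 \<Rightarrow> 'e::comm_ring_1 \<Rightarrow> 'e"
  assumes "comm_algebra scale"
  shows "(D, S) \<in> MS scale \<longleftrightarrow>
    range fps_of_poly \<subseteq> D \<and> S \<in> extensional D \<and>
    (\<forall>X\<in>D. \<forall>Y\<in>D. X + Y \<in> D \<and> X * Y \<in> D \<and> S (X + Y) = S X + S Y \<and> S (X * Y) = S X * S Y) \<and>
    S 1 = 1 \<and> S fps_X = 1 \<and> (\<forall>r. S (fps_const r) = scale r 1)"
    (is "?L \<longleftrightarrow> ?R")
proof -
  interpret comm_algebra scale by fact
  have scale: "scale r y = scale r 1 * y" for r y
    using scale_mult_left[of r 1 y] by simp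
  have base: "1 \<in> D \<and> fps_X \<in> D \<and> fps_const r \<in> D \<and> 1 - fps_X \<in> D" if "range fps_of_poly \<subseteq> D" for r
  proof -
    have "fps_of_poly 1 \<in> D" "fps_of_poly [:0, 1:] \<in> D" "fps_of_poly [:r:] \<in> D" "fps_of_poly (1 - [:0, 1:]) \<in> D"
      using that by blast+
    then show ?thesis
      by (simp add: fps_of_poly_pCons fps_of_poly_diff)
  qed
  show ?thesis
  proof
    assume L: ?L
    then have D: "range fps_of_poly \<subseteq> D"
      by (simp add: MS_def)
    have add: "S (X + Y) = S X + S Y" if "X \<in> D" "Y \<in> D" for X Y
      using L that by (simp add: MS_def fps_algebra_hom_def)
    have one: "S 1 = 1" and "S (fps_const r * 1) = scale r (S 1)" for r
      using L base[OF D] unfolding MS_def fps_algebra_hom_def by blast+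
    then have "S (fps_const r) = scale r 1" for r
      by simp
    moreover have "S ((1 - fps_X) * 1) = 0"
      using L base[OF D] by (simp add: MS_def del: mult_1_right)
    then have "S fps_X = 1"
      using add[of "1 - fps_X" fps_X] base[OF D] one by simp
    ultimately show ?R
      using L by (simp add: MS_def fps_algebra_hom_def fps_subalgebra_def)
  next
    assume R: ?R
    then have D: "range fps_of_poly \<subseteq> D" and one: "S 1 = 1" "S fps_X = 1" "\<And>r. S (fps_const r) = scale r 1"
      and add: "\<And>X Y. X \<in> D \<Longrightarrow> Y \<in> D \<Longrightarrow> S (X + Y) = S X + S Y"
      and mult: "\<And>X Y. X \<in> D \<Longrightarrow> Y \<in> D \<Longrightarrow> S (X * Y) = S X * S Y"
      by simp_all
    have "S (1 - fps_X) = 0"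
      using add[of "1 - fps_X" fps_X] base[OF D] one by simp
    then have "S ((1 - fps_X) * X) = 0" if "X \<in> D" for X
      using mult[of "1 - fps_X" X] base[OF D] that by simp
    moreover have "S (fps_const r * X) = scale r (S X)" if "X \<in> D" for r X
      using mult[of "fps_const r" X] base[OF D, of r] that one(3)[of r] scale[of r "S X"] by simp
    ultimately show ?L
      using R base[OF D] unfolding MS_def fps_algebra_hom_def fps_subalgebra_def by simp
  qed
qed

lemma extendsD:
  assumes "extends scale T S"
  shows "T \<in> MS scale" "S \<in> MS scale"
  using assms by (simp_all add: extends_def)

lemma extends_refl: "S \<in> MS scale \<Longrightarrow> extends scale S S"
  by (simp add: extends_def)

lemma extends_trans: "extends scale S\<^sub>3 S\<^sub>2 \<Longrightarrow> extends scale S\<^sub>2 S\<^sub>1 \<Longrightarrow> extends scale S\<^sub>3 S\<^sub>1"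
  by (auto simp: extends_def)

text \<open>Agreement on the common domain gives equality because elements of \<open>MS\<close> are
  \<open>undefined\<close> outside their domains.\<close>

lemma extends_antisym:
  assumes "extends scale S T" "extends scale T S"
  shows "S = T"
proof (rule prod_eqI)
  show D: "fst S = fst T"
    using assms by (auto simp: extends_def)
  show "snd S = snd T"
  proof (rule extensionalityI[of _ "fst S"])
    show "snd S \<in> extensional (fst S)" "snd T \<in> extensional (fst S)"
      using assms D by (auto simp: extends_def MS_def)
    show "snd S X = snd T X" if "X \<in> fst S" for X
      using assms that by (simp add: extends_def)
  qed
qed

section \<open>Maximal extensions by Zorn's lemma\<close>

text \<open>Maximality is demanded in all of \<open>MS\<close>, not relative to \<open>S\<close>, so
  a maximal extension of \<open>S\<close> is also one of every \<open>T\<close> that it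
  extends.\<close>

definition maximal_extension ::
  "('r::comm_ring_1 \<Rightarrow> 'e::comm_ring_1 \<Rightarrow> 'e) \<Rightarrow> ('r, 'e) summation \<Rightarrow> ('r, 'e) summation \<Rightarrow> bool" where
  "maximal_extension scale M S \<longleftrightarrow> extends scale M S \<and> (\<forall>N. extends scale N M \<longrightarrow> N = M)"

lemma maximal_extensionD: "maximal_extension scale M S \<Longrightarrow> extends scale M S"
  by (simp add: maximal_extension_def)

lemma maximal_extension_mono:
  "maximal_extension scale M T \<Longrightarrow> extends scale T S \<Longrightarrow> maximal_extension scale M S"
  by (auto simp: maximal_extension_def intro: extends_trans)

lemma maximal_extension_weaken:
  "maximal_extension scale M S \<Longrightarrow> extends scale M T \<Longrightarrow> maximal_extension scale M T"
  by (simp add: maximal_extension_def)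

text \<open>The union of the chain works: any two series of the union lie in one member, whose laws
  then apply to them.\<close>

lemma chain_upper_bound:
  fixes scale :: "'r::comm_ring_1 \<Rightarrow> 'e::comm_ring_1 \<Rightarrow> 'e"
  assumes alg: "comm_algebra scale"
    and MS: "C \<subseteq> MS scale" and "C \<noteq> {}"
    and chain: "\<And>S T. S \<in> C \<Longrightarrow> T \<in> C \<Longrightarrow> extends scale S T \<or> extends scale T S"
  shows "\<exists>U. \<forall>S\<in>C. extends scale U S"
proof -
  define D where "D = (\<Union>T\<in>C. fst T)"
  define f where "f = restrict (\<lambda>X. snd (SOME T. T \<in> C \<and> X \<in> fst T) X) D"
  \<comment> \<open>\<open>SOME\<close> picks an unspecified member containing \<open>X\<close>;
    members of a chain agree wherever both are defined, so the choice does not matter.\<close>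
  have f: "f X = snd T X" if "T \<in> C" "X \<in> fst T" for T X
  proof -
    define T' where "T' = (SOME T. T \<in> C \<and> X \<in> fst T)"
    have "T' \<in> C \<and> X \<in> fst T'"
      unfolding T'_def by (rule someI[of _ T]) (use that in simp)
    then have "snd T' X = snd T X"
      using chain[of T T'] that by (auto simp: extends_def)
    moreover have "X \<in> D"
      using that by (auto simp: D_def)
    ultimately show ?thesis
      by (simp add: f_def T'_def)
  qed
  have MS_C: "range fps_of_poly \<subseteq> fst T \<and>
    (\<forall>X\<in>fst T. \<forall>Y\<in>fst T. X + Y \<in> fst T \<and> X * Y \<in> fst T \<and>
       snd T (X + Y) = snd T X + snd T Y \<and> snd T (X * Y) = snd T X * snd T Y) \<and>
    snd T 1 = 1 \<and> snd T fps_X = 1 \<and> (\<forall>r. snd T (fps_const r) = scale r 1)" if "T \<in> C" for T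
    using that MS MS_iff[OF alg, of "fst T" "snd T"] by auto
  obtain T\<^sub>0 where T\<^sub>0: "T\<^sub>0 \<in> C"
    using \<open>C \<noteq> {}\<close> by blast
  have "(D, f) \<in> MS scale"
    unfolding MS_iff[OF alg]
  proof (intro conjI ballI allI)
    show "range fps_of_poly \<subseteq> D"
      using MS_C[OF T\<^sub>0] T\<^sub>0 by (auto simp: D_def)
    show "f \<in> extensional D"
      by (simp add: f_def)
    have "fps_of_poly p \<in> fst T\<^sub>0" for p
      using MS_C[OF T\<^sub>0] by blast
    from this[of 1] this[of "[:0, 1:]"] this[of "[:_:]"]
    have "1 \<in> fst T\<^sub>0" "fps_X \<in> fst T\<^sub>0" "fps_const r \<in> fst T\<^sub>0" for r
      by (simp_all add: fps_of_poly_pCons)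
    then show "f 1 = 1" "f fps_X = 1" "f (fps_const r) = scale r 1" for r
      using f[OF T\<^sub>0] MS_C[OF T\<^sub>0] by auto
    fix X Y
    assume "X \<in> D" "Y \<in> D"
    then obtain T where T: "T \<in> C" "X \<in> fst T" "Y \<in> fst T"
      using chain unfolding D_def extends_def by blast
    then show "X + Y \<in> D" "X * Y \<in> D" "f (X + Y) = f X + f Y" "f (X * Y) = f X * f Y"
      using f[OF T(1)] MS_C[OF T(1)] by (auto simp: D_def intro!: bexI[of _ T])
  qed
  moreover have "fst T \<subseteq> D" if "T \<in> C" for T
    using that by (auto simp: D_def)
  ultimately have "extends scale (D, f) T" if "T \<in> C" for T
    using that MS f by (auto simp: extends_def)
  then show ?thesis
    by blast
qed

lemma maximal_extension_exists:
  fixes scale :: "'r::comm_ring_1 \<Rightarrow> 'e::comm_ring_1 \<Rightarrow> 'e"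
  assumes alg: "comm_algebra scale" and S: "S \<in> MS scale"
  obtains M where "maximal_extension scale M S"
proof -
  define A where "A = {T. extends scale T S}"
  define le where "le = (\<lambda>S T. extends scale T S)"
  have "partial_order_on A (relation_of le A)"
    unfolding A_def le_def
    by (rule partial_order_on_relation_ofI)
      (blast intro: extends_refl[of _ scale] extends_trans extends_antisym dest: extends_def[THEN iffD1])+
  moreover have "\<exists>u\<in>A. \<forall>a\<in>C. le a u" if C: "C \<in> Chains (relation_of le A)" for C
  proof (cases "C = {}")
    case True
    then show ?thesis
      using extends_refl[OF S] unfolding A_def by blast
  next
    case False
    have "C \<subseteq> A" "\<And>S T. S \<in> C \<Longrightarrow> T \<in> C \<Longrightarrow> extends scale S T \<or> extends scale T S"
      using C by (auto simp: Chains_def relation_of_def le_def)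
    moreover from this have "C \<subseteq> MS scale"
      by (auto simp: A_def extends_def)
    ultimately obtain U where U: "\<forall>T\<in>C. extends scale U T"
      using chain_upper_bound[OF alg _ False] by blast
    then have "extends scale U S"
      using False \<open>C \<subseteq> A\<close> by (auto simp: A_def intro: extends_trans)
    with U show ?thesis
      unfolding A_def le_def by blast
  qed
  ultimately have "\<exists>m\<in>A. \<forall>a\<in>A. le m a \<longrightarrow> a = m"
    by (rule predicate_Zorn)
  then obtain M where "extends scale M S" "\<And>N. extends scale N S \<Longrightarrow> extends scale N M \<Longrightarrow> N = M"
    unfolding A_def le_def by blast
  \<comment> \<open>Every extension of \<open>M\<close> extends \<open>S\<close>, so maximality
    among the extensions of \<open>S\<close> is maximality in \<open>MS\<close>.\<close>
  then have "maximal_extension scale M S"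
    unfolding maximal_extension_def using extends_trans by blast
  then show ?thesis
    by (rule that)
qed

text \<open>The cofactor has degree 0 and leading coefficient 1. This gives the uniqueness behind
  \<open>THE\<close> in \<open>scalar_poly\<close>.\<close>

lemma monic_dvd_antisym:
  fixes p q :: "'a::idom poly"
  assumes "lead_coeff p = 1" "lead_coeff q = 1" "p dvd q" "q dvd p"
  shows "p = q"
proof -
  obtain k where k: "q = p * k"
    using assms(3) by (elim dvdE)
  have "p \<noteq> 0" "q \<noteq> 0"
    using assms(1,2) by auto
  then have "degree p = degree q"
    using assms(3,4) by (simp add: dvd_imp_degree_le antisym)
  then have "degree k = 0"
    using k \<open>q \<noteq> 0\<close> by (auto simp: degree_mult_eq)
  moreover have "lead_coeff k = 1"
    using k assms(1,2) by (simp add: lead_coeff_mult)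
  ultimately show ?thesis
    using k by (metis degree_0_id mult.right_neutral one_pCons)
qed

text \<open>The homomorphism laws of \<open>f\<close> are inherited from \<open>M\<close>, so a
  domain below \<open>M\<close> need only contain the polynomials in \<open>fps_X\<close> and be
  closed under sums and products.\<close>

lemma extends_subsummation:
  fixes scale :: "'r::comm_ring_1 \<Rightarrow> 'e::comm_ring_1 \<Rightarrow> 'e"
  assumes alg: "comm_algebra scale" and M: "M \<in> MS scale"
    and C: "C \<subseteq> fst M" "range fps_of_poly \<subseteq> C"
      "\<And>X Y. X \<in> C \<Longrightarrow> Y \<in> C \<Longrightarrow> X + Y \<in> C \<and> X * Y \<in> C"
    and f: "f \<in> extensional C" "\<And>X. X \<in> C \<Longrightarrow> f X = snd M X"
  shows "extends scale M (C, f)"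
proof -
  have "fps_of_poly p \<in> C" for p
    using C by blast
  from this[of 1] this[of "[:0, 1:]"] this[of "[:_:]"]
  have "1 \<in> C" "fps_X \<in> C" "fps_const r \<in> C" for r
    by (simp_all add: fps_of_poly_pCons)
  moreover have "(fst M, snd M) \<in> MS scale"
    using M by simp
  ultimately have "(C, f) \<in> MS scale"
    using C f unfolding MS_iff[OF alg] by (simp add: subset_iff)
  then show ?thesis
    using M C f by (simp add: extends_def)
qed

section \<open>Arithmetic in a fixed summation and in its polynomials\<close>

locale mult_summation =
  fixes scale :: "'r::comm_ring_1 \<Rightarrow> 'e::field \<Rightarrow> 'e" and D :: "'r fps set" and S :: "'r fps \<Rightarrow> 'e"
  assumes alg: "comm_algebra scale" and MS: "(D, S) \<in> MS scale"
begin

lemma fps_of_poly_mem: "fps_of_poly p \<in> D"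
  using MS by (auto simp: MS_iff[OF alg])

lemma const_mem: "fps_const r \<in> D"
  using fps_of_poly_mem[of "[:r:]"] by (simp add: fps_of_poly_pCons)

lemma zero_mem: "0 \<in> D" and one_mem: "1 \<in> D"
  using const_mem[of 0] const_mem[of 1] by simp_all

lemma add_mem: "X \<in> D \<Longrightarrow> Y \<in> D \<Longrightarrow> X + Y \<in> D"
  and mult_mem: "X \<in> D \<Longrightarrow> Y \<in> D \<Longrightarrow> X * Y \<in> D"
  and S_add: "X \<in> D \<Longrightarrow> Y \<in> D \<Longrightarrow> S (X + Y) = S X + S Y"
  and S_mult: "X \<in> D \<Longrightarrow> Y \<in> D \<Longrightarrow> S (X * Y) = S X * S Y"
  and S_one: "S 1 = 1" and S_X: "S fps_X = 1" and S_const: "S (fps_const r) = scale r 1"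
  using MS by (simp_all add: MS_iff[OF alg])

lemma uminus_mem: "X \<in> D \<Longrightarrow> - X \<in> D"
  using mult_mem[OF const_mem[of "-1"], of X] by (simp flip: fps_const_neg)

lemma diff_mem: "X \<in> D \<Longrightarrow> Y \<in> D \<Longrightarrow> X - Y \<in> D"
  using add_mem[OF _ uminus_mem, of X Y] by simp

lemma power_mem: "X \<in> D \<Longrightarrow> X ^ n \<in> D"
  by (induction n) (simp_all add: one_mem mult_mem)

lemma sum_mem: "(\<And>i. i \<in> I \<Longrightarrow> f i \<in> D) \<Longrightarrow> sum f I \<in> D"
  by (induction I rule: infinite_finite_induct) (simp_all add: zero_mem add_mem)

lemma S_zero: "S 0 = 0"
  using S_add[OF zero_mem zero_mem] add_left_imp_eq[of "S 0" "S 0" 0] by simp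

lemma S_diff: "X \<in> D \<Longrightarrow> Y \<in> D \<Longrightarrow> S (X - Y) = S X - S Y"
  using S_add[OF diff_mem, of X Y Y] by simp

lemma S_power: "X \<in> D \<Longrightarrow> S (X ^ n) = S X ^ n"
  by (induction n) (simp_all add: S_one S_mult power_mem)

lemma S_sum: "(\<And>i. i \<in> I \<Longrightarrow> f i \<in> D) \<Longrightarrow> S (sum f I) = (\<Sum>i\<in>I. S (f i))"
  by (induction I rule: infinite_finite_induct) (simp_all add: S_zero S_add sum_mem)

definition polys :: "'r fps poly set" where
  "polys = {P. \<forall>i. coeff P i \<in> D}"

abbreviation Spoly :: "'r fps poly \<Rightarrow> 'e poly" where
  "Spoly \<equiv> map_poly S"

lemma coeff_mem: "P \<in> polys \<Longrightarrow> coeff P i \<in> D"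
  by (simp add: polys_def)

lemma coeff_Spoly: "coeff (Spoly P) i = S (coeff P i)"
  by (simp add: coeff_map_poly S_zero)

lemma const_poly: "X \<in> D \<Longrightarrow> [:X:] \<in> polys"
  by (auto simp: polys_def coeff_pCons zero_mem split: nat.split)

lemma monom_poly: "X \<in> D \<Longrightarrow> monom X n \<in> polys"
  by (auto simp: polys_def zero_mem)

lemma add_poly: "P \<in> polys \<Longrightarrow> Q \<in> polys \<Longrightarrow> P + Q \<in> polys"
  by (simp add: polys_def add_mem)

lemma diff_poly: "P \<in> polys \<Longrightarrow> Q \<in> polys \<Longrightarrow> P - Q \<in> polys"
  by (simp add: polys_def diff_mem)

lemma mult_poly: "P \<in> polys \<Longrightarrow> Q \<in> polys \<Longrightarrow> P * Q \<in> polys"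
  by (simp add: polys_def coeff_mult sum_mem mult_mem)

lemma Spoly_const: "Spoly [:X:] = [:S X:]"
  by (simp add: map_poly_pCons S_zero)

lemma Spoly_monom: "Spoly (monom X n) = monom (S X) n"
  by (simp add: map_poly_monom S_zero)

lemma Spoly_add: "P \<in> polys \<Longrightarrow> Q \<in> polys \<Longrightarrow> Spoly (P + Q) = Spoly P + Spoly Q"
  by (simp add: poly_eq_iff coeff_Spoly coeff_mem S_add)

lemma Spoly_diff: "P \<in> polys \<Longrightarrow> Q \<in> polys \<Longrightarrow> Spoly (P - Q) = Spoly P - Spoly Q"
  by (simp add: poly_eq_iff coeff_Spoly coeff_mem S_diff)

lemma Spoly_mult: "P \<in> polys \<Longrightarrow> Q \<in> polys \<Longrightarrow> Spoly (P * Q) = Spoly P * Spoly Q"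
  by (simp add: poly_eq_iff coeff_Spoly coeff_mem coeff_mult S_sum S_mult mult_mem)

text \<open>\<open>S\<close> may kill leading coefficients, so \<open>Spoly P\<close> can have
  smaller degree than \<open>P\<close>; the surplus terms are 0. The bound \<open>degree P\<close>
  matches the expansion of \<open>poly P X\<close>.\<close>

lemma poly_Spoly: "poly (Spoly P) x = (\<Sum>i\<le>degree P. S (coeff P i) * x ^ i)"
proof -
  have "poly (Spoly P) x = (\<Sum>i\<le>degree P. coeff (Spoly P) i * x ^ i)"
    unfolding poly_altdef
    by (rule sum.mono_neutral_left) (auto simp: map_poly_degree_leq coeff_eq_0)
  then show ?thesis
    by (simp add: coeff_Spoly)
qed

lemma S_poly:
  assumes "P \<in> polys" "X \<in> D"
  shows "S (poly P X) = poly (Spoly P) (S X)"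
  using assms by (simp add: poly_altdef[of P] poly_Spoly S_sum S_mult S_power coeff_mem mult_mem power_mem)

section \<open>Adjoining one series to a summation\<close>

text \<open>The kernel of evaluation at \<open>X\<close> on \<open>D[T]\<close>.\<close>

definition relations :: "'r fps \<Rightarrow> 'r fps poly set" where
  "relations X = {P \<in> polys. poly P X = 0}"

lemma annihilators_eq: "annihilators (D, S) X = {P \<in> relations X. Spoly P \<noteq> 0}"
  by (auto simp: annihilators_def relations_def polys_def)

text \<open>The ring \<open>D[X]\<close> with the map taking \<open>P(X)\<close> to
  \<open>S(P)(x)\<close>. \<open>SOME\<close> selects a polynomial representing \<open>Y\<close>;
  this is a sound choice once \<open>x\<close> is a root of the images of all relations of
  \<open>X\<close>.\<close>

definition adjoin :: "'r fps \<Rightarrow> 'e \<Rightarrow> ('r, 'e) summation" where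
  "adjoin X x = ((\<lambda>P. poly P X) ` polys,
     restrict (\<lambda>Y. poly (Spoly (SOME P. P \<in> polys \<and> poly P X = Y)) x) ((\<lambda>P. poly P X) ` polys))"

text \<open>Two representatives of one series differ by a relation, whose image vanishes at
  \<open>x\<close>.\<close>

lemma snd_adjoin:
  assumes x: "\<And>P. P \<in> relations X \<Longrightarrow> poly (Spoly P) x = 0" and P: "P \<in> polys"
  shows "snd (adjoin X x) (poly P X) = poly (Spoly P) x"
proof -
  define Q where "Q = (SOME Q. Q \<in> polys \<and> poly Q X = poly P X)"
  have Q: "Q \<in> polys \<and> poly Q X = poly P X"
    unfolding Q_def by (rule someI[of _ P]) (use P in simp)
  then have "poly (Spoly (Q - P)) x = 0"
    using P by (intro x) (simp add: relations_def diff_poly)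
  then have "poly (Spoly Q) x = poly (Spoly P) x"
    using P Q by (simp add: Spoly_diff)
  then show ?thesis
    using P by (simp add: adjoin_def Q_def)
qed

text \<open>Evaluation at \<open>X\<close>, as well as \<open>Spoly\<close> followed by evaluation
  at \<open>x\<close>, respects sums and products, so the laws pass from \<open>D[T]\<close> to
  \<open>D[X]\<close>. Constant polynomials embed \<open>D\<close>.\<close>

lemma adjoin:
  assumes x: "\<And>P. P \<in> relations X \<Longrightarrow> poly (Spoly P) x = 0"
  shows "extends scale (adjoin X x) (D, S)" "X \<in> fst (adjoin X x)" "snd (adjoin X x) X = x"
proof -
  have val: "snd (adjoin X x) (poly P X) = poly (Spoly P) x" if "P \<in> polys" for P
    using x that by (rule snd_adjoin)
  have mem: "poly P X \<in> fst (adjoin X x)" if "P \<in> polys" for P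
    using that by (simp add: adjoin_def)
  have D: "Y \<in> fst (adjoin X x)" "snd (adjoin X x) Y = S Y" if "Y \<in> D" for Y
    using val[OF const_poly[OF that]] const_poly[OF that]
      mem[OF const_poly[OF that]] by (simp_all add: Spoly_const)
  have X_mem: "fps_X \<in> D"
    using fps_of_poly_mem[of "[:0,1:]"] by (simp add: fps_of_poly_pCons)
  have "(fst (adjoin X x), snd (adjoin X x)) \<in> MS scale"
    unfolding MS_iff[OF alg]
  proof (intro conjI ballI allI)
    show "range fps_of_poly \<subseteq> fst (adjoin X x)"
      using D fps_of_poly_mem by auto
    show "snd (adjoin X x) \<in> extensional (fst (adjoin X x))"
      by (simp add: adjoin_def)
    show "snd (adjoin X x) 1 = 1" "snd (adjoin X x) fps_X = 1"
      "snd (adjoin X x) (fps_const r) = scale r 1" for r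
      using D one_mem X_mem const_mem S_one S_X S_const by auto
    fix Y Z
    assume "Y \<in> fst (adjoin X x)" "Z \<in> fst (adjoin X x)"
    then obtain P Q where "P \<in> polys" "Q \<in> polys" "Y = poly P X" "Z = poly Q X"
      by (auto simp: adjoin_def)
    then show "Y + Z \<in> fst (adjoin X x)" "Y * Z \<in> fst (adjoin X x)"
      "snd (adjoin X x) (Y + Z) = snd (adjoin X x) Y + snd (adjoin X x) Z"
      "snd (adjoin X x) (Y * Z) = snd (adjoin X x) Y * snd (adjoin X x) Z"
      using val[of P] val[of Q] val[of "P + Q"] val[of "P * Q"]
        mem[of "P + Q"] mem[of "P * Q"]
      by (simp_all add: add_poly mult_poly Spoly_add Spoly_mult)
  qed
  then show "extends scale (adjoin X x) (D, S)"
    using D MS by (auto simp: extends_def)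
  \<comment> \<open>The polynomial \<open>T\<close> itself: it evaluates to \<open>X\<close>, and
    its image to \<open>x\<close>.\<close>
  have T: "monom 1 1 \<in> polys"
    by (rule monom_poly[OF one_mem])
  then show "X \<in> fst (adjoin X x)"
    using mem by (fastforce simp: poly_monom)
  show "snd (adjoin X x) X = x"
    using val[OF T] by (simp add: poly_monom Spoly_monom S_one)
qed

text \<open>Sufficiency is \<open>adjoin\<close>. For necessity, an extension with value
  \<open>x\<close> at \<open>X\<close> is applied to \<open>P(X) = 0\<close>.\<close>

lemma extension_value_iff:
  "(\<exists>T. extends scale T (D, S) \<and> X \<in> fst T \<and> snd T X = x) \<longleftrightarrow>
     (\<forall>P\<in>relations X. poly (Spoly P) x = 0)" (is "?L \<longleftrightarrow> ?R")
proof
  assume ?R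
  then show ?L
    using adjoin[of X x] by blast
next
  assume ?L
  then obtain T where T: "extends scale T (D, S)" "X \<in> fst T" "snd T X = x"
    by blast
  interpret T: mult_summation scale "fst T" "snd T"
    using T(1) by (intro mult_summation.intro alg) (simp add: extends_def)
  show ?R
  proof
    fix P
    assume P: "P \<in> relations X"
    then have "map_poly (snd T) P = Spoly P"
      using T(1) by (auto simp: poly_eq_iff coeff_Spoly T.coeff_Spoly relations_def polys_def extends_def)
    moreover have "P \<in> T.polys"
      using P T(1) by (auto simp: relations_def polys_def T.polys_def extends_def)
    ultimately show "poly (Spoly P) x = 0"
      using T.S_poly[of P X] T(2,3) P by (simp add: relations_def T.S_zero)
  qed
qed

section \<open>Scalar polynomials and their roots\<close>

text \<open>
  Pseudo-division over \<open>D\<close>, since \<open>S(D)\<close> need not be a field.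
\<close>

lemma minimal_dvd:
  assumes min: "is_minimal_for (D, S) X P" and Q: "Q \<in> relations X"
  shows "Spoly P dvd Spoly Q"
  using Q
proof (induction "degree (Spoly Q)" arbitrary: Q rule: less_induct)
  case less
  have P: "P \<in> relations X" "Spoly P \<noteq> 0"
    and le: "\<And>Q. Q \<in> relations X \<Longrightarrow> Spoly Q \<noteq> 0 \<Longrightarrow> degree (Spoly P) \<le> degree (Spoly Q)"
    using min by (auto simp: is_minimal_for_def is_arg_min_linorder annihilators_eq)
  \<comment> \<open>These are degrees of the images: the leading coefficients of \<open>P\<close>
    and \<open>Q\<close> may be sent to 0, while \<open>p\<close> and \<open>q\<close> are the ones
    whose values lead.\<close>
  define m n where "m = degree (Spoly P)" and "n = degree (Spoly Q)"
  define p q where "p = coeff P m" and "q = coeff Q n"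
  \<comment> \<open>Again a relation, and in its image the terms of degree \<open>n\<close> cancel,
    so the induction hypothesis applies unless the image is 0.\<close>
  define Q' where "Q' = [:p:] * Q - monom q (n - m) * P"
  show ?case
  proof (cases "Spoly Q = 0")
    case False
    then have "m \<le> n"
      using le less.prems by (simp add: m_def n_def)
    have polys: "P \<in> polys" "Q \<in> polys" "[:p:] \<in> polys" "monom q (n - m) \<in> polys"
      using P less.prems by (simp_all add: relations_def p_def q_def const_poly monom_poly coeff_mem)
    then have Q': "Q' \<in> relations X"
      using P less.prems diff_poly[OF mult_poly mult_poly] by (simp add: Q'_def relations_def del: mult_pCons_left)
    have Sp: "S p = lead_coeff (Spoly P)" and Sq: "S q = lead_coeff (Spoly Q)"
      by (simp_all add: p_def q_def m_def n_def coeff_Spoly)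
    have "Spoly Q' = [:S p:] * Spoly Q - monom (S q) (n - m) * Spoly P"
      unfolding Q'_def using polys
      by (simp add: Spoly_diff Spoly_mult mult_poly Spoly_const Spoly_monom del: mult_pCons_left)
    then have SQ': "Spoly Q' = smult (S p) (Spoly Q) - monom (S q) (n - m) * Spoly P"
      by simp
    have "Spoly P dvd Spoly Q'"
    proof (cases "Spoly Q' = 0")
      case Q'0: False
      have "degree (Spoly Q') \<le> n"
        unfolding SQ' using \<open>m \<le> n\<close> degree_mult_le[of "monom (S q) (n - m)" "Spoly P"]
          degree_monom_le[of "S q" "n - m"]
        by (intro degree_diff_le) (auto simp: n_def m_def intro: order.trans[OF degree_smult_le])
      moreover have "coeff (Spoly Q') n = 0"
        using \<open>m \<le> n\<close> by (simp add: SQ' Sp Sq coeff_monom_mult m_def n_def)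
      ultimately have "degree (Spoly Q') < n"
        using Q'0 by (metis le_neq_implies_less leading_coeff_0_iff)
      then show ?thesis
        using less.hyps Q' by (simp add: n_def)
    qed simp
    then have "Spoly P dvd Spoly Q' + monom (S q) (n - m) * Spoly P"
      by simp
    then have "Spoly P dvd smult (S p) (Spoly Q)"
      by (simp add: SQ')
    \<comment> \<open>\<open>S p\<close> is a nonzero element of the field \<open>E\<close> and can
      be cancelled.\<close>
    then show ?thesis
      using P(2) Sp by (simp add: dvd_smult_iff)
  qed simp
qed

text \<open>The description in \<open>scalar_poly\<close> is unique: normalising the image of a
  minimal polynomial gives a candidate, and by \<open>minimal_dvd\<close> any two candidates divide
  each other.\<close>

lemma scalar_poly:
  assumes "annihilators (D, S) X \<noteq> {}"
  obtains P c where "is_minimal_for (D, S) X P" "c \<noteq> 0" "lead_coeff (scalar_poly (D, S) X) = 1"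
    "scalar_poly (D, S) X = smult c (Spoly P)"
proof -
  define ok where "ok = (\<lambda>s. lead_coeff s = 1 \<and>
    (\<exists>P c. is_minimal_for (D, S) X P \<and> c \<noteq> 0 \<and> s = smult c (Spoly P)))"
  have relation: "P \<in> relations X" "Spoly P \<noteq> 0" if "is_minimal_for (D, S) X P" for P
    using that by (auto simp: is_minimal_for_def is_arg_min_linorder annihilators_eq)
  obtain P where P: "is_minimal_for (D, S) X P"
    using assms
    by (metis (no_types, lifting) arg_min_nat_lemma ex_in_conv is_arg_min_linorder is_minimal_for_def)
  have "ok (smult (inverse (lead_coeff (Spoly P))) (Spoly P))"
    using P relation[OF P] unfolding ok_def
    by (auto intro!: exI[of _ P] exI[of _ "inverse (lead_coeff (Spoly P))"])
  moreover have "s = s'" if s: "ok s" and s': "ok s'" for s s'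
  proof -
    have "s dvd s'" if "ok s" "ok s'" for s s'
      using that minimal_dvd relation unfolding ok_def
      by (auto intro!: dvd_smult simp: smult_dvd_iff)
    then show ?thesis
      using s s' monic_dvd_antisym[of s s'] by (simp add: ok_def)
  qed
  ultimately have "ok (THE s. ok s)"
    by (blast intro: theI)
  moreover have "(THE s. ok s) = scalar_poly (D, S) X"
    using assms by (simp add: scalar_poly_def ok_def)
  ultimately show ?thesis
    using that by (auto simp: ok_def)
qed

lemma scalar_poly_lead: "scalar_poly (D, S) X \<noteq> 0 \<Longrightarrow> lead_coeff (scalar_poly (D, S) X) = 1"
  using scalar_poly[of X] by (metis scalar_poly_def)

text \<open>Without annihilators every relation has image 0, so each \<open>x\<close> is a possible
  value, as the zero polynomial says. Otherwise the scalar polynomial is, up to a nonzero factor,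
  the image of one relation and divides the images of all.\<close>

lemma poly_scalar_poly_eq_0_iff:
  "poly (scalar_poly (D, S) X) x = 0 \<longleftrightarrow>
     (\<exists>T. extends scale T (D, S) \<and> X \<in> fst T \<and> snd T X = x)"
  unfolding extension_value_iff
proof (cases "annihilators (D, S) X = {}")
  case True
  then show "poly (scalar_poly (D, S) X) x = 0 \<longleftrightarrow> (\<forall>P\<in>relations X. poly (Spoly P) x = 0)"
    by (auto simp: scalar_poly_def annihilators_eq)
next
  case False
  then obtain P c where P: "is_minimal_for (D, S) X P" "c \<noteq> 0"
    "scalar_poly (D, S) X = smult c (Spoly P)"
    by (rule scalar_poly)
  then have "P \<in> relations X"
    by (auto simp: is_minimal_for_def is_arg_min_linorder annihilators_eq)
  then show "poly (scalar_poly (D, S) X) x = 0 \<longleftrightarrow> (\<forall>P\<in>relations X. poly (Spoly P) x = 0)"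
    using P minimal_dvd[OF P(1)] by (auto simp: poly_eq_0_iff_dvd intro: dvd_trans)
qed

end

section \<open>The univalent extension as the meet of all maximal extensions\<close>

locale alg_closed_summation = mult_summation scale D S
  for scale :: "'r::comm_ring_1 \<Rightarrow> 'e::alg_closed_field \<Rightarrow> 'e" and D S
begin

text \<open>Algebraic closedness enters twice: a nonconstant scalar polynomial has a root, and one
  with a single root is a power of a linear factor.\<close>

lemma abs_univalent_iff:
  "abs_univalent_with_root scale (D, S) X \<rho> \<longleftrightarrow>
     (\<forall>M. maximal_extension scale M (D, S) \<longrightarrow> X \<in> fst M \<and> snd M X = \<rho>)" (is "?L \<longleftrightarrow> ?R")
proof
  assume L: ?L
  show ?R
  proof (intro allI impI)
    fix M
    assume M: "maximal_extension scale M (D, S)"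
    interpret M: mult_summation scale "fst M" "snd M"
      using maximal_extensionD[OF M] by (intro mult_summation.intro alg) (simp add: extends_def)
    have "degree (scalar_poly (fst M, snd M) X) > 0"
      using L maximal_extensionD[OF M]
      unfolding abs_univalent_with_root_def abs_algebraic_def is_algebraic_def prod.collapse by blast
    then obtain x where "poly (scalar_poly (fst M, snd M) X) x = 0"
      using alg_closed_imp_poly_has_root by blast
    \<comment> \<open>The root gives an extension of \<open>M\<close> defined at \<open>X\<close>,
      which by maximality is \<open>M\<close>.\<close>
    then obtain T where "extends scale T M" "X \<in> fst T" "snd T X = x"
      unfolding M.poly_scalar_poly_eq_0_iff by auto
    then have X: "X \<in> fst M"
      using M unfolding maximal_extension_def by blast
    then have "poly (scalar_poly (D, S) X) (snd M X) = 0"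
      unfolding poly_scalar_poly_eq_0_iff using maximal_extensionD[OF M] by blast
    then show "X \<in> fst M \<and> snd M X = \<rho>"
      using X L by (auto simp: abs_univalent_with_root_def)
  qed
next
  assume R: ?R
  \<comment> \<open>Needed for every extension \<open>T\<close>, since absolute algebraicity
    quantifies over all of them. Values in extensions of \<open>T\<close> persist in maximal
    extensions, which are also maximal over \<open>(D, S)\<close>.\<close>
  have roots: "poly (scalar_poly T X) x = 0 \<longleftrightarrow> x = \<rho>" if T: "extends scale T (D, S)" for T x
  proof -
    interpret T: mult_summation scale "fst T" "snd T"
      using T by (intro mult_summation.intro alg) (simp add: extends_def)
    have iff: "poly (scalar_poly T X) x = 0 \<longleftrightarrow> (\<exists>T'. extends scale T' T \<and> X \<in> fst T' \<and> snd T' X = x)"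
      using T.poly_scalar_poly_eq_0_iff[of X x] unfolding prod.collapse .
    show ?thesis
    proof
      assume "poly (scalar_poly T X) x = 0"
      then obtain T' where T': "extends scale T' T" "X \<in> fst T'" "snd T' X = x"
        using iff by blast
      obtain M where M: "maximal_extension scale M T'"
        using maximal_extension_exists[OF alg extendsD(1)[OF T'(1)]] .
      then have "snd M X = \<rho>"
        using R maximal_extension_mono[OF M extends_trans[OF T'(1) T]] by blast
      then show "x = \<rho>"
        using maximal_extensionD[OF M] T'(2,3) by (simp add: extends_def)
    next
      assume x: "x = \<rho>"
      obtain M where M: "maximal_extension scale M T"
        using maximal_extension_exists[OF alg extendsD(1)[OF T]] .
      then have "X \<in> fst M \<and> snd M X = \<rho>"
        using R maximal_extension_mono[OF M T] by blast
      then show "poly (scalar_poly T X) x = 0"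
        using iff x maximal_extensionD[OF M] by blast
    qed
  qed
  \<comment> \<open>A constant vanishing at \<open>\<rho>\<close> would vanish at
    \<open>\<rho> + 1\<close> too.\<close>
  have deg: "degree (scalar_poly T X) > 0" if T: "extends scale T (D, S)" for T
  proof (rule ccontr)
    assume "\<not> ?thesis"
    then obtain c where "scalar_poly T X = [:c:]"
      by (auto elim: degree_eq_zeroE)
    then show False
      using roots[OF T, of \<rho>] roots[OF T, of "\<rho> + 1"] by simp
  qed
  define s where "s = scalar_poly (D, S) X"
  have s: "degree s > 0" "\<And>x. poly s x = 0 \<longleftrightarrow> x = \<rho>"
    using deg roots extends_refl[OF MS] by (auto simp: s_def)
  moreover have "lead_coeff s = 1"
    unfolding s_def by (rule scalar_poly_lead) (use s in \<open>auto simp: s_def\<close>)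
  moreover obtain A where A: "size A = degree s" "s = smult (lead_coeff s) (\<Prod>x\<in>#A. [:-x, 1:])"
    using s(1) alg_closed_imp_factorization[of s] by fastforce
  ultimately have A_prod: "s = (\<Prod>x\<in>#A. [:-x, 1:])"
    by simp
  have "x = \<rho>" if "x \<in># A" for x
  proof -
    have "poly s x = 0"
      using that by (subst A_prod) (auto simp: poly_prod_mset prod_mset_zero_iff)
    then show ?thesis
      using s(2) by simp
  qed
  then have "A = replicate_mset (degree s) \<rho>"
    using A(1) set_mset_subset_singletonD[of A \<rho>] by auto
  then have "(\<Prod>x\<in>#A. [:-x, 1:]) = [:-\<rho>, 1:] ^ degree s"
    by (metis image_replicate_mset prod_mset_replicate_mset)
  then have "s = [:-\<rho>, 1:] ^ degree s"
    unfolding A_prod[symmetric] .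
  then show ?L
    using deg s(1) unfolding abs_univalent_with_root_def abs_algebraic_def is_algebraic_def s_def by blast
qed

text \<open>Any single maximal extension determines the root, so \<open>THE\<close> is
  well-defined.\<close>

lemma univalent_ext_eq:
  assumes M: "maximal_extension scale M (D, S)" and X: "X \<in> fst (univalent_ext scale (D, S))"
  shows "X \<in> fst M" "snd (univalent_ext scale (D, S)) X = snd M X"
proof -
  obtain \<rho> where \<rho>: "abs_univalent_with_root scale (D, S) X \<rho>"
    using X by (auto simp: univalent_ext_def Let_def)
  show "X \<in> fst M"
    using M \<rho> unfolding abs_univalent_iff by blast
  have "snd M X = \<rho>'" if "abs_univalent_with_root scale (D, S) X \<rho>'" for \<rho>'
    using M that unfolding abs_univalent_iff by blast
  then have "(THE \<rho>. abs_univalent_with_root scale (D, S) X \<rho>) = snd M X"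
    using \<rho> by (intro the_equality) auto
  then show "snd (univalent_ext scale (D, S)) X = snd M X"
    using \<rho> by (auto simp: univalent_ext_def Let_def)
qed

lemma univalent_ext_memI:
  "(\<And>M. maximal_extension scale M (D, S) \<Longrightarrow> X \<in> fst M \<and> snd M X = \<rho>) \<Longrightarrow>
     X \<in> fst (univalent_ext scale (D, S))"
  unfolding univalent_ext_def Let_def fst_conv abs_univalent_iff by blast

text \<open>Closure under sums and products holds because each maximal extension is closed and all
  of them give the same values.\<close>

lemma maximal_extends_univalent_ext:
  assumes M: "maximal_extension scale M (D, S)"
  shows "extends scale M (univalent_ext scale (D, S))"
proof -
  let ?U = "univalent_ext scale (D, S)"
  have "extends scale M (fst ?U, snd ?U)"
  proof (rule extends_subsummation[OF alg])
    show "M \<in> MS scale"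
      using maximal_extensionD[OF M] by (simp add: extends_def)
    show "fst ?U \<subseteq> fst M" "\<And>X. X \<in> fst ?U \<Longrightarrow> snd ?U X = snd M X"
      using univalent_ext_eq[OF M] by auto
    show "snd ?U \<in> extensional (fst ?U)"
      by (simp add: univalent_ext_def Let_def)
    show "range fps_of_poly \<subseteq> fst ?U"
    proof
      fix X :: "'r fps"
      assume "X \<in> range fps_of_poly"
      then have "X \<in> D"
        using fps_of_poly_mem by blast
      then show "X \<in> fst ?U"
        by (intro univalent_ext_memI[of _ "S X"]) (fastforce simp: extends_def dest: maximal_extensionD)
    qed
    fix X Y
    assume XY: "X \<in> fst ?U" "Y \<in> fst ?U"
    \<comment> \<open>The right-hand sides do not depend on \<open>N\<close>, as
      \<open>univalent_ext_memI\<close> requires.\<close>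
    have sum_prod: "X + Y \<in> fst N \<and> snd N (X + Y) = snd ?U X + snd ?U Y"
      "X * Y \<in> fst N \<and> snd N (X * Y) = snd ?U X * snd ?U Y"
      if N: "maximal_extension scale N (D, S)" for N
    proof -
      interpret N: mult_summation scale "fst N" "snd N"
        using maximal_extensionD[OF N] by (intro mult_summation.intro alg) (simp add: extends_def)
      show "X + Y \<in> fst N \<and> snd N (X + Y) = snd ?U X + snd ?U Y"
        "X * Y \<in> fst N \<and> snd N (X * Y) = snd ?U X * snd ?U Y"
        using univalent_ext_eq[OF N] XY
        by (simp_all add: N.add_mem N.mult_mem N.S_add N.S_mult)
    qed
    show "X + Y \<in> fst ?U \<and> X * Y \<in> fst ?U"
      using univalent_ext_memI[OF sum_prod(1)] univalent_ext_memI[OF sum_prod(2)] by simp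
  qed
  then show ?thesis
    by simp
qed

text \<open>With \<open>maximal_extends_univalent_ext\<close> this makes the univalent extension the
  greatest lower bound of the maximal extensions.\<close>

lemma univalent_ext_greatest:
  assumes T: "\<And>M. maximal_extension scale M (D, S) \<Longrightarrow> extends scale M T"
  shows "extends scale (univalent_ext scale (D, S)) T"
proof -
  obtain M where M: "maximal_extension scale M (D, S)"
    using maximal_extension_exists[OF alg MS] .
  have "X \<in> fst (univalent_ext scale (D, S))" if "X \<in> fst T" for X
    by (rule univalent_ext_memI[of _ "snd T X"]) (use T that in \<open>auto simp: extends_def\<close>)
  then show ?thesis
    using univalent_ext_eq[OF M] T[OF M] maximal_extends_univalent_ext[OF M]
    by (auto simp: extends_def)
qed

end

section \<open>Rational and telescopic extensions lie below every maximal extension\<close>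

text \<open>
  The rational and telescopic extensions differ only in the set of admissible denominators.
\<close>

definition fraction_value ::
  "'r::comm_ring_1 fps set \<Rightarrow> ('r, 'e::field) summation \<Rightarrow> 'r fps \<Rightarrow> 'e \<Rightarrow> bool" where
  "fraction_value Bs S X x \<longleftrightarrow>
     (\<exists>A\<in>fst S. \<exists>B\<in>Bs. A = B * X \<and> snd S B \<noteq> 0 \<and> snd S A = snd S B * x)"

definition fraction_ext ::
  "'r::comm_ring_1 fps set \<Rightarrow> ('r, 'e::field) summation \<Rightarrow> ('r, 'e) summation" where
  "fraction_ext Bs S =
     (let QD = {X. \<exists>x. fraction_value Bs S X x}
      in (QD, restrict (\<lambda>X. THE x. fraction_value Bs S X x) QD))"

lemma rational_ext_eq_fraction_ext: "rational_ext S = fraction_ext (fst S) S"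
  by (simp add: rational_ext_def fraction_ext_def rational_value_def fraction_value_def)

lemma telescopic_ext_eq_fraction_ext: "telescopic_ext S = fraction_ext (range fps_of_poly) S"
  by (simp add: telescopic_ext_def fraction_ext_def telescopic_value_def fraction_value_def)

context mult_summation
begin

text \<open>The fraction value \<open>x\<close> satisfies every relation of \<open>X\<close> over
  \<open>M\<close>, so \<open>M\<close> extends to \<open>X\<close> with value \<open>x\<close>; by
  maximality it already has that value. In particular \<open>x\<close> is unique.\<close>

lemma fraction_value_in_maximal:
  assumes M: "maximal_extension scale M (D, S)" and Bs: "Bs \<subseteq> D"
    and X: "fraction_value Bs (D, S) X x"
  shows "X \<in> fst M \<and> snd M X = x"
proof -
  have M_MS: "M \<in> MS scale" and DM: "D \<subseteq> fst M" "\<And>Y. Y \<in> D \<Longrightarrow> snd M Y = S Y"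
    using maximal_extensionD[OF M] by (auto simp: extends_def)
  interpret M: mult_summation scale "fst M" "snd M"
    using M_MS by (intro mult_summation.intro alg) simp
  obtain A B where AB: "A \<in> D" "B \<in> D" "A = B * X" "S B \<noteq> 0" "S A = S B * x"
    using X Bs by (auto simp: fraction_value_def)
  then have ABM: "A \<in> fst M" "B \<in> fst M" "snd M A = S B * x" "snd M B = S B"
    using DM by auto
  have "poly (M.Spoly P) x = 0" if P: "P \<in> M.relations X" for P
  proof -
    define n where "n = degree P"
    have P_mem: "coeff P i \<in> fst M" for i
      using P by (simp add: M.relations_def M.coeff_mem)
    \<comment> \<open>Clearing denominators: multiplying by \<open>B ^ n\<close> turns each
      \<open>X ^ i\<close> into \<open>A ^ i * B ^ (n - i)\<close>, to which \<open>M\<close>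
      applies although \<open>X\<close> may lie outside its domain.\<close>
    have "0 = B ^ n * poly P X"
      using P by (simp add: M.relations_def)
    also have "\<dots> = (\<Sum>i\<le>n. coeff P i * (A ^ i * B ^ (n - i)))"
      unfolding poly_altdef n_def[symmetric] sum_distrib_left
    proof (rule sum.cong[OF refl])
      fix i
      assume "i \<in> {..n}"
      then have "B ^ n = B ^ i * B ^ (n - i)"
        by (simp flip: power_add)
      then show "B ^ n * (coeff P i * X ^ i) = coeff P i * (A ^ i * B ^ (n - i))"
        by (simp add: AB(3) power_mult_distrib algebra_simps)
    qed
    finally have "0 = snd M (\<Sum>i\<le>n. coeff P i * (A ^ i * B ^ (n - i)))"
      using M.S_zero by simp
    also have "\<dots> = (\<Sum>i\<le>n. snd M (coeff P i) * ((S B * x) ^ i * S B ^ (n - i)))"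
      using ABM P_mem by (simp add: M.S_sum M.S_mult M.S_power M.mult_mem M.power_mem)
    also have "\<dots> = S B ^ n * poly (M.Spoly P) x"
      unfolding M.poly_Spoly n_def[symmetric] sum_distrib_left
    proof (rule sum.cong[OF refl])
      fix i
      assume "i \<in> {..n}"
      then have "S B ^ n = S B ^ i * S B ^ (n - i)"
        by (simp flip: power_add)
      then show "snd M (coeff P i) * ((S B * x) ^ i * S B ^ (n - i)) =
          S B ^ n * (snd M (coeff P i) * x ^ i)"
        by (simp add: power_mult_distrib algebra_simps)
    qed
    finally show ?thesis
      using AB(4) by simp
  qed
  then obtain T where "extends scale T M" "X \<in> fst T" "snd T X = x"
    using M.extension_value_iff[of X x] by auto
  then show ?thesis
    using M unfolding maximal_extension_def by blast
qed

text \<open>Values come from a maximal extension by \<open>fraction_value_in_maximal\<close>;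
  multiplicative closure of \<open>Bs\<close> supplies common denominators.\<close>

lemma fraction_ext:
  assumes Bs: "Bs \<subseteq> D" "1 \<in> Bs" "\<And>B C. B \<in> Bs \<Longrightarrow> C \<in> Bs \<Longrightarrow> B * C \<in> Bs"
  shows "extends scale (fraction_ext Bs (D, S)) (D, S)"
    and "maximal_extension scale M (D, S) \<Longrightarrow> extends scale M (fraction_ext Bs (D, S))"
proof -
  let ?Q = "fraction_ext Bs (D, S)"
  \<comment> \<open>A suitable \<open>x\<close> always exists in the field \<open>E\<close>, namely
    \<open>S (B * X) / S B\<close>, so membership concerns only the denominator.\<close>
  have mem_iff: "X \<in> fst ?Q \<longleftrightarrow> (\<exists>B\<in>Bs. B * X \<in> D \<and> S B \<noteq> 0)" for X
  proof -
    have "\<exists>x. S (B * X) = S B * x" if "S B \<noteq> 0" for B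
      using that by (intro exI[of _ "S (B * X) / S B"]) simp
    then show ?thesis
      unfolding fraction_ext_def fraction_value_def Let_def fst_conv snd_conv by fast
  qed
  have D_Q: "D \<subseteq> fst ?Q"
    using Bs(2) by (auto simp: mem_iff S_one intro!: bexI[of _ 1])
  have val: "X \<in> fst M \<and> snd ?Q X = snd M X"
    if M: "maximal_extension scale M (D, S)" and X: "X \<in> fst ?Q" for M X
  proof -
    obtain x where x: "fraction_value Bs (D, S) X x"
      using X by (auto simp: fraction_ext_def Let_def)
    note eq = fraction_value_in_maximal[OF M Bs(1)]
    have "(THE x. fraction_value Bs (D, S) X x) = x"
      using x eq by (metis the_equality)
    then show ?thesis
      using x eq[OF x] by (auto simp: fraction_ext_def Let_def)
  qed
  have max: "extends scale M ?Q" if M: "maximal_extension scale M (D, S)" for M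
  proof -
    have "extends scale M (fst ?Q, snd ?Q)"
    proof (rule extends_subsummation[OF alg])
      show "M \<in> MS scale"
        using maximal_extensionD[OF M] by (simp add: extends_def)
      show "fst ?Q \<subseteq> fst M" "\<And>X. X \<in> fst ?Q \<Longrightarrow> snd ?Q X = snd M X"
        using val[OF M] by auto
      show "range fps_of_poly \<subseteq> fst ?Q"
        using D_Q fps_of_poly_mem by blast
      show "snd ?Q \<in> extensional (fst ?Q)"
        by (simp add: fraction_ext_def Let_def)
      fix X Y
      assume "X \<in> fst ?Q" "Y \<in> fst ?Q"
      then obtain B C where B: "B \<in> Bs" "B * X \<in> D" "S B \<noteq> 0" and C: "C \<in> Bs" "C * Y \<in> D" "S C \<noteq> 0"
        by (auto simp: mem_iff)
      then have BC: "B \<in> D" "C \<in> D" "B * C \<in> Bs" "S (B * C) \<noteq> 0"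
        using Bs by (auto simp: S_mult subset_iff)
      have "(B * C) * (X + Y) = C * (B * X) + B * (C * Y)" "(B * C) * (X * Y) = (B * X) * (C * Y)"
        by (simp_all add: algebra_simps)
      then have "(B * C) * (X + Y) \<in> D" "(B * C) * (X * Y) \<in> D"
        using B(2) C(2) BC by (metis add_mem mult_mem)+
      then show "X + Y \<in> fst ?Q \<and> X * Y \<in> fst ?Q"
        using BC by (auto simp: mem_iff)
    qed
    then show ?thesis
      by simp
  qed
  then show "maximal_extension scale M (D, S) \<Longrightarrow> extends scale M ?Q" .
  obtain M where M: "maximal_extension scale M (D, S)"
    using maximal_extension_exists[OF alg MS] .
  show "extends scale ?Q (D, S)"
    using D_Q val[OF M] max[OF M] maximal_extensionD[OF M] by (auto simp: extends_def)
qed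

end

section \<open>Deriving the properties of the univalent extension\<close>

lemma maximal_extends_univalent:
  fixes scale :: "'r::comm_ring_1 \<Rightarrow> 'e::alg_closed_field \<Rightarrow> 'e"
  assumes "comm_algebra scale" "maximal_extension scale M S"
  shows "extends scale M (univalent_ext scale S)"
proof -
  interpret alg_closed_summation scale "fst S" "snd S"
    using assms maximal_extensionD[OF assms(2)]
    by (intro alg_closed_summation.intro mult_summation.intro) (simp_all add: extends_def)
  show ?thesis
    using maximal_extends_univalent_ext[of M] assms by simp
qed

lemma univalent_greatest:
  fixes scale :: "'r::comm_ring_1 \<Rightarrow> 'e::alg_closed_field \<Rightarrow> 'e"
  assumes "comm_algebra scale" "S \<in> MS scale"
    and "\<And>M. maximal_extension scale M S \<Longrightarrow> extends scale M T"
  shows "extends scale (univalent_ext scale S) T"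
proof -
  interpret alg_closed_summation scale "fst S" "snd S"
    using assms by (intro alg_closed_summation.intro mult_summation.intro) simp_all
  show ?thesis
    using univalent_ext_greatest[of T] assms by simp
qed

text \<open>By \<open>ext\<close> and \<open>max\<close>, \<open>S\<close> and
  \<open>\<Psi> S\<close> have the same maximal extensions, hence the same univalent extension.
  Maximal extensions of \<open>S\<close> are also maximal over its univalent extension, so they
  extend \<open>\<Psi>\<close> of it, which therefore adds nothing.\<close>

lemma subsumesI:
  fixes scale :: "'r::comm_ring_1 \<Rightarrow> 'e::alg_closed_field \<Rightarrow> 'e"
  assumes alg: "comm_algebra scale"
    and ext: "\<And>S. S \<in> MS scale \<Longrightarrow> extends scale (\<Psi> S) S"
    and max: "\<And>M S. maximal_extension scale M S \<Longrightarrow> extends scale M (\<Psi> S)"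
  shows "subsumes scale (univalent_ext scale) \<Psi>"
  unfolding subsumes_def
proof
  fix S
  assume S: "S \<in> MS scale"
  let ?U = "univalent_ext scale"
  note below = maximal_extends_univalent[OF alg]
  have US: "?U S \<in> MS scale" and PsiS: "\<Psi> S \<in> MS scale"
    using extendsD(1)[OF univalent_greatest[OF alg S maximal_extensionD]] extendsD(1)[OF ext[OF S]]
    by blast+
  have "extends scale (?U (\<Psi> S)) (?U S)"
    using univalent_greatest[OF alg PsiS] below maximal_extension_mono[OF _ ext[OF S]] by blast
  moreover have "extends scale (?U S) (?U (\<Psi> S))"
    using univalent_greatest[OF alg S] below maximal_extension_weaken[OF _ max] by blast
  moreover have "extends scale (?U S) (\<Psi> (?U S))"
    using univalent_greatest[OF alg S] max maximal_extension_weaken[OF _ below] by blast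
  ultimately show "?U (\<Psi> S) = ?U S \<and> \<Psi> (?U S) = ?U S"
    using ext[OF US] by (blast intro: extends_antisym)
qed

text \<open>The denominators may vary with \<open>S\<close>: all of \<open>fst S\<close> in the
  rational case, a fixed set in the telescopic one.\<close>

lemma subsumes_fraction_ext:
  fixes scale :: "'r::comm_ring_1 \<Rightarrow> 'e::alg_closed_field \<Rightarrow> 'e"
  assumes alg: "comm_algebra scale"
    and Bs: "\<And>S. S \<in> MS scale \<Longrightarrow> Bs S \<subseteq> fst S" "\<And>S. S \<in> MS scale \<Longrightarrow> 1 \<in> Bs S"
      "\<And>S B C. S \<in> MS scale \<Longrightarrow> B \<in> Bs S \<Longrightarrow> C \<in> Bs S \<Longrightarrow> B * C \<in> Bs S"
  shows "subsumes scale (univalent_ext scale) (\<lambda>S. fraction_ext (Bs S) S)"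
proof (rule subsumesI[OF alg])
  have S: "extends scale (fraction_ext (Bs S) S) S"
    "maximal_extension scale M S \<Longrightarrow> extends scale M (fraction_ext (Bs S) S)"
    if "S \<in> MS scale" for M S
  proof -
    interpret mult_summation scale "fst S" "snd S"
      using that by (intro mult_summation.intro alg) simp
    show "extends scale (fraction_ext (Bs S) S) S"
      "maximal_extension scale M S \<Longrightarrow> extends scale M (fraction_ext (Bs S) S)"
      using fraction_ext[of "Bs S"] Bs that by simp_all
  qed
  show "extends scale (fraction_ext (Bs S) S) S" if "S \<in> MS scale" for S
    using S(1)[OF that] .
  show "extends scale M (fraction_ext (Bs S) S)" if "maximal_extension scale M S" for M S
    using S(2) that maximal_extensionD[OF that] by (auto simp: extends_def)
qed

theorem theorem4p5:
  fixes scale :: "'r::comm_ring_1 \<Rightarrow> 'e::alg_closed_field \<Rightarrow> 'e"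
  assumes "comm_algebra scale"
  shows "univalent_ext scale \<in> MS scale \<rightarrow> MS scale \<and>
         extension_map scale (univalent_ext scale) \<and>
         idempotent_map scale (univalent_ext scale) \<and>
         mult_canonical_map scale (univalent_ext scale) \<and>
         preserves_mult_compatibility scale (univalent_ext scale) \<and>
         subsumes scale (univalent_ext scale) telescopic_ext \<and>
         subsumes scale (univalent_ext scale) rational_ext"
proof (intro conjI)
  let ?U = "univalent_ext scale"
  note alg = assms
  note below = maximal_extends_univalent[OF alg]
  have ext: "extends scale (?U S) S" if "S \<in> MS scale" for S
    using univalent_greatest[OF alg that maximal_extensionD] .
  \<comment> \<open>With \<open>T\<close> an extension of \<open>S\<close>, this gives canonicity,
    since \<open>M\<close> extends both \<open>T\<close> and \<open>?U S\<close>; with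
    \<open>T\<close> a common extension, it gives preservation of compatibility.\<close>
  have common: "\<exists>M. extends scale M T \<and> extends scale M (?U S\<^sub>1) \<and> extends scale M (?U S\<^sub>2)"
    if T: "extends scale T S\<^sub>1" "extends scale T S\<^sub>2" for T S\<^sub>1 S\<^sub>2
  proof -
    obtain M where M: "maximal_extension scale M T"
      using maximal_extension_exists[OF alg extendsD(1)[OF T(1)]] .
    then show ?thesis
      using below maximal_extension_mono[OF M] T maximal_extensionD[OF M] by blast
  qed
  show "?U \<in> MS scale \<rightarrow> MS scale" "extension_map scale ?U"
    using ext by (auto simp: extends_def extension_map_def)
  \<comment> \<open>Idempotence is self-subsumption.\<close>
  have "subsumes scale ?U ?U"
    using ext below by (rule subsumesI[OF alg])
  then show "idempotent_map scale ?U"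
    by (simp add: subsumes_def idempotent_map_def)
  show "mult_canonical_map scale ?U"
    unfolding mult_canonical_map_def mult_canonical_def mult_compatible_def
    using ext common by blast
  show "preserves_mult_compatibility scale ?U"
    unfolding preserves_mult_compatibility_def mult_compatible_def
    using common by blast
  have MS: "range fps_of_poly \<subseteq> fst S" "\<And>B C. B \<in> fst S \<Longrightarrow> C \<in> fst S \<Longrightarrow> B * C \<in> fst S" "1 \<in> fst S"
    if "S \<in> MS scale" for S
    using that by (auto simp: MS_def fps_subalgebra_def)
  have "subsumes scale ?U (\<lambda>S. fraction_ext (fst S) S)"
    by (rule subsumes_fraction_ext[OF alg]) (use MS in auto)
  then show "subsumes scale ?U rational_ext"
    by (simp add: rational_ext_eq_fraction_ext[abs_def])
  have "subsumes scale ?U (fraction_ext (range fps_of_poly))"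
  proof (rule subsumes_fraction_ext[OF alg])
    show "1 \<in> range (fps_of_poly :: 'r poly \<Rightarrow> _)"
      by (rule image_eqI[of _ _ 1]) simp_all
    show "B * C \<in> range fps_of_poly" if "B \<in> range fps_of_poly" "C \<in> range fps_of_poly" for B C :: "'r fps"
      using that by (auto simp flip: fps_of_poly_mult)
  qed (use MS in auto)
  then show "subsumes scale ?U telescopic_ext"
    by (simp add: telescopic_ext_eq_fraction_ext[abs_def])
qed

end
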